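(* Let $B=\mathbb{F}_q$, $F=\mathbb{F}_{q^\ell}$ with $\ell>1$. Suppose $\mathcal{A}$ is a $d$-dimensional $B$-linear subspace of $F$ and $(\ell-d+1)\mid\ell$. Then the repair bandwidth $b$ of any I/O-optimal linear repair scheme for ${\rm RS}(\mathcal{A},q^d-2)$ satisfies: (i) if $d=\ell$ and $q>2$, then $b=(q^\ell-1)\ell-q^{\ell-1}$; (ii) if $d=\ell$ and $q=2$, then $b\geq(2^\ell-1)\ell-3\cdot2^{\ell-2}$; (iii) if $d<\ell$, then $b\geq(q^d-1)d-q^{2d-\ell-1}$.
   Context: ${\rm Tr}_{F/B}$ is the trace from $F$ to $B$. For $\mathcal{A}=\{\alpha_1,\dots,\alpha_n\}\subseteq F$ (distinct elements) and $1\le k<n$, ${\rm RS}(\mathcal{A},k)=\{(f(\alpha_1),\dots,f(\alpha_n)): f\in F[x],\ \deg f\le k-1\}$; coordinate $i$ is called node $i$. When $\mathcal{A}$ is a $B$-linear subspace of $F$, ${\rm RS}(\mathcal{A},k)^\perp={\rm RS}(\mathcal{A},n-k)$. A linear repair scheme (over $B$) for node $i^*$ of ${\rm RS}(\mathcal{A},k)$ is a list of $\ell$ polynomials $g_1,\dots,g_\ell\in F[x]$ of degree less than $n-k$ such that $g_1(\alpha_{i^*}),\dots,g_\ell(\alpha_{i^*})$ are linearly independent over $B$. Given a basis $\mathcal{B}=\{\beta^{(1)},\dots,\beta^{(\ell)}\}$ of $F$ over $B$, for $i\in\{1,\dots,n\}$ let $W_i$ be the $\ell\times\ell$ matrix over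 $B$ whose $(j,s)$ entry is ${\rm Tr}_{F/B}(g_j(\alpha_i)\beta^{(s)})$. The I/O cost with respect to $\mathcal{B}$ is $\gamma_{I/O}=\sum_{i=1}^n{\rm nz}(W_i)-\ell=\sum_{i\ne i^*}{\rm nz}(W_i)$, where ${\rm nz}(W)$ is the number of nonzero columns of $W$; the repair bandwidth is $b=\sum_{i=1}^n{\rm rank}(W_i)-\ell=\sum_{i\ne i^*}{\rm rank}(W_i)$ (it does not depend on the basis). A linear repair scheme for (a node of) ${\rm RS}(\mathcal{A},q^d-2)$, with $\mathcal{A}$ a $d$-dimensional $B$-subspace and $n=q^d$, is called I/O-optimal if its I/O cost with respect to some basis $\mathcal{B}$ of $F$ over $B$ equals $(n-1)\ell-(\ell-d+1)q^{d-1}$ (which is a lower bound for the I/O cost of every linear repair scheme of this code). *)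

theory Defs
  imports "HOL-Analysis.Analysis" "HOL-Computational_Algebra.Polynomial"
begin

text \<open>
  The extension \<open>F/B\<close> of finite fields is given by two types \<open>'b\<close> (for \<open>B\<close>) and \<open>'f\<close> (for \<open>F\<close>)
  together with a homomorphism \<open>emb\<close> from \<open>B\<close> to \<open>F\<close>. Linear algebra over \<open>B\<close> inside \<open>F\<close> is
  the library's, instantiated with the scalar multiplication \<open>bscale emb\<close>.
\<close>

definition field_embedding :: "('b::field \<Rightarrow> 'f::field) \<Rightarrow> bool" where
  "field_embedding emb \<longleftrightarrow>
     emb 1 = 1 \<and> (\<forall>x y. emb (x + y) = emb x + emb y) \<and> (\<forall>x y. emb (x * y) = emb x * emb y)"

definition bscale :: "('b::field \<Rightarrow> 'f::field) \<Rightarrow> 'b \<Rightarrow> 'f \<Rightarrow> 'f" where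
  "bscale emb b x = emb b * x"

lemma vector_space_bscale: "field_embedding emb \<Longrightarrow> vector_space (bscale emb)"
  by unfold_locales (simp_all add: field_embedding_def bscale_def algebra_simps)

definition ext_degree :: "('b::field \<Rightarrow> 'f::field) \<Rightarrow> nat" where
  "ext_degree emb = vector_space.dim (bscale emb) UNIV"

text \<open>
  With \<open>q = |B|\<close> the trace of \<open>x\<close> is the sum of the conjugates \<open>x ^ (q ^ i)\<close>, \<open>i < [F:B]\<close>. This
  sum lies in the image of \<open>emb\<close>; the trace is its preimage.
\<close>
definition field_trace :: "('b::{field,finite} \<Rightarrow> 'f::{field,finite}) \<Rightarrow> 'f \<Rightarrow> 'b" where
  "field_trace emb x = (THE b. emb b = (\<Sum>i<ext_degree emb. x ^ (CARD('b) ^ i)))"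

text \<open>Linear independence is that of a family, so repeated vectors are excluded.\<close>
definition indep_family :: "('b::field \<Rightarrow> 'f::field) \<Rightarrow> ('l \<Rightarrow> 'f) \<Rightarrow> bool" where
  "indep_family emb v \<longleftrightarrow> inj v \<and> \<not> module.dependent (bscale emb) (range v)"

definition is_basis :: "('b::field \<Rightarrow> 'f::field) \<Rightarrow> ('l \<Rightarrow> 'f) \<Rightarrow> bool" where
  "is_basis emb \<beta> \<longleftrightarrow> indep_family emb \<beta> \<and> module.span (bscale emb) (range \<beta>) = UNIV"

text \<open>
  The nodes of \<open>RS(A, k)\<close> are identified with the evaluation points, i.e. with the elements of \<open>A\<close>.
  The \<open>\<ell>\<close> polynomials of a scheme are indexed by a finite type \<open>'l\<close> with \<open>\<ell>\<close> elements.
\<close>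
definition linear_repair_scheme ::
    "('b::field \<Rightarrow> 'f::field) \<Rightarrow> 'f set \<Rightarrow> nat \<Rightarrow> 'f \<Rightarrow> ('l::finite \<Rightarrow> 'f poly) \<Rightarrow> bool" where
  "linear_repair_scheme emb A k a g \<longleftrightarrow>
     a \<in> A \<and> (\<forall>j. g j = 0 \<or> degree (g j) < card A - k) \<and> indep_family emb (\<lambda>j. poly (g j) a)"

definition repair_matrix ::
    "('b::{field,finite} \<Rightarrow> 'f::{field,finite}) \<Rightarrow> ('l::finite \<Rightarrow> 'f) \<Rightarrow> ('l \<Rightarrow> 'f poly) \<Rightarrow> 'f \<Rightarrow> 'b^'l^'l" where
  "repair_matrix emb \<beta> g x = (\<chi> j s. field_trace emb (poly (g j) x * \<beta> s))"

definition nonzero_columns :: "'b::zero^'n^'m \<Rightarrow> nat" where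
  "nonzero_columns W = card {s. column s W \<noteq> 0}"

definition io_cost ::
    "('b::{field,finite} \<Rightarrow> 'f::{field,finite}) \<Rightarrow> 'f set \<Rightarrow> ('l::finite \<Rightarrow> 'f) \<Rightarrow> ('l \<Rightarrow> 'f poly) \<Rightarrow> int" where
  "io_cost emb A \<beta> g = (\<Sum>x\<in>A. int (nonzero_columns (repair_matrix emb \<beta> g x))) - int CARD('l)"

definition repair_bandwidth ::
    "('b::{field,finite} \<Rightarrow> 'f::{field,finite}) \<Rightarrow> 'f set \<Rightarrow> ('l::finite \<Rightarrow> 'f) \<Rightarrow> ('l \<Rightarrow> 'f poly) \<Rightarrow> int" where
  "repair_bandwidth emb A \<beta> g = (\<Sum>x\<in>A. int (rank (repair_matrix emb \<beta> g x))) - int CARD('l)"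

text \<open>Used only for \<open>d\<close>-dimensional subspaces \<open>A\<close> with \<open>d \<ge> 1\<close>, so \<open>d - 1\<close> is not truncated.\<close>
definition io_optimal_scheme ::
    "('b::{field,finite} \<Rightarrow> 'f::{field,finite}) \<Rightarrow> nat \<Rightarrow> 'f set \<Rightarrow> 'f \<Rightarrow> ('l::finite \<Rightarrow> 'f poly) \<Rightarrow> bool" where
  "io_optimal_scheme emb d A a g \<longleftrightarrow>
     linear_repair_scheme emb A (CARD('b) ^ d - 2) a g \<and>
     (\<exists>\<beta>::'l \<Rightarrow> 'f. is_basis emb \<beta> \<and>
        io_cost emb A \<beta> g =
          (int (CARD('b) ^ d) - 1) * int CARD('l)
            - (int CARD('l) - int d + 1) * int (CARD('b) ^ (d - 1)))"

end

theory Submission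
  imports Defs
begin

text \<open>
  Translate the failed node to \<open>0\<close> and write \<open>g\<^sub>j(a + y) = w\<^sub>j + y v\<^sub>j\<close>, where the \<open>w\<^sub>j\<close> form a basis.
  Trace duality yields a \<open>B\<close>-linear map \<open>S\<close> such that \<open>\<ell> - rank W\<^sub>y\<close> is the dimension of
  \<open>K\<^sub>y = {z. S(y z) = z}\<close>, while the zero columns of \<open>W\<^sub>y\<close> correspond to the \<open>\<beta>\<^sub>s \<in> K\<^sub>y\<close>. For each \<open>s\<close> the
  set \<open>{y \<in> A. \<beta>\<^sub>s \<in> K\<^sub>y}\<close> is empty or a coset of a proper subspace of \<open>A\<close> that embeds into \<open>ker S\<close>, and
  it can be nonempty only if \<open>\<beta>\<^sub>s\<close> lies in the range of \<open>S\<close>. Comparing dimensions, I/O-optimality leaves two cases.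
  Generically, exactly \<open>\<ell> - d + 1\<close> of the \<open>\<beta>\<^sub>s\<close> occur, they span the range of \<open>S\<close>, and
  \<open>S(y \<beta>\<^sub>s) \<in> B \<beta>\<^sub>s\<close> for all \<open>y \<in> A\<close>; then \<open>K\<^sub>y\<close> is spanned by the \<open>\<beta>\<^sub>s\<close> it contains and the bandwidth equals
  the I/O cost. The only other possibility is \<open>d = \<ell>\<close>, \<open>q = 2\<close> with \<open>ker S\<close> of codimension \<open>2\<close>, where
  counting the pairs \<open>(y, z)\<close> with \<open>0 \<noteq> z \<in> K\<^sub>y\<close> gives the bound.
\<close>

section \<open>Cardinalities of subspaces and of fibres of additive maps\<close>

lemma (in vector_space) card_span_independent:
  assumes fin: "finite (UNIV :: 'a set)" "finite S" and S: "independent S"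
  shows "card (span S) = CARD('a) ^ card S"
proof -
  let ?h = "\<lambda>u. \<Sum>v\<in>S. u v *s v"
  have "inj_on ?h (S \<rightarrow>\<^sub>E UNIV)"
  proof (rule inj_onI)
    fix u u' assume u: "u \<in> S \<rightarrow>\<^sub>E UNIV" "u' \<in> S \<rightarrow>\<^sub>E UNIV" and eq: "?h u = ?h u'"
    have "(\<Sum>v\<in>S. (u v - u' v) *s v) = 0"
      using eq by (simp add: scale_left_diff_distrib sum_subtractf)
    then have "u v - u' v = 0" if "v \<in> S" for v
      using independentD[OF S fin(2) subset_refl, of "\<lambda>v. u v - u' v" v] that by simp
    with u show "u = u'" by (intro PiE_ext[where s = "\<lambda>_. UNIV"]) auto
  qed
  moreover have "?h ` (S \<rightarrow>\<^sub>E UNIV) = span S"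
  proof -
    have "?h u \<in> ?h ` (S \<rightarrow>\<^sub>E UNIV)" for u
      by (rule image_eqI[where x = "restrict u S"]) auto
    then show ?thesis
      unfolding span_finite[OF fin(2)] by blast
  qed
  ultimately have "card (span S) = card (S \<rightarrow>\<^sub>E (UNIV :: 'a set))"
    using card_image by fastforce
  then show ?thesis using fin by (simp add: card_PiE)
qed

lemma (in vector_space) card_subspace:
  assumes "finite (UNIV :: 'a set)" "finite V" "subspace V"
  shows "card V = CARD('a) ^ dim V"
proof -
  obtain S where S: "S \<subseteq> V" "independent S" "V \<subseteq> span S" "card S = dim V"
    using basis_exists by blast
  moreover have "span S = V"
    using S assms(3) span_minimal by blast
  ultimately show ?thesis
    using card_span_independent[of S] assms finite_subset by metis
qed

text \<open>Translating by one preimage \<open>x0\<close> of \<open>c\<close> carries the fibre over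
  0 onto the fibre over \<open>c\<close>, so all nonempty fibres in \<open>V\<close> have equal
  size.\<close>

lemma card_additive_image:
  fixes h :: "'x::ab_group_add \<Rightarrow> 'y::ab_group_add"
  assumes fin: "finite V" and add: "\<And>x y. h (x + y) = h x + h y"
    and V: "\<And>x y. x \<in> V \<Longrightarrow> y \<in> V \<Longrightarrow> x + y \<in> V" "\<And>x y. x \<in> V \<Longrightarrow> y \<in> V \<Longrightarrow> x - y \<in> V"
  shows "c \<in> h ` V \<Longrightarrow> card {x \<in> V. h x = c} = card {x \<in> V. h x = 0}"
    and "card V = card (h ` V) * card {x \<in> V. h x = 0}"
proof -
  have *: "card {x \<in> V. h x = c} = card {x \<in> V. h x = 0}" if c: "c \<in> h ` V" for c
  proof -
    obtain x0 where x0: "x0 \<in> V" "h x0 = c" using c by blast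
    have diff: "h (x - y) = h x - h y" for x y
      using add[of "x - y" y] by (simp add: algebra_simps)
    have "bij_betw (\<lambda>x. x + x0) {x \<in> V. h x = 0} {x \<in> V. h x = c}"
      by (rule bij_betw_byWitness[where f' = "\<lambda>x. x - x0"]) (use x0 V in \<open>auto simp: add diff\<close>)
    then show ?thesis by (simp add: bij_betw_same_card)
  qed
  then show "c \<in> h ` V \<Longrightarrow> card {x \<in> V. h x = c} = card {x \<in> V. h x = 0}" .
  have "card V = (\<Sum>c\<in>h ` V. card {x \<in> V. h x = c})"
    using sum.image_gen[OF fin, of "\<lambda>_. 1::nat" h] by simp
  also have "\<dots> = (\<Sum>c\<in>h ` V. card {x \<in> V. h x = 0})"
    using * by (rule sum.cong[OF refl])
  finally show "card V = card (h ` V) * card {x \<in> V. h x = 0}" by simp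
qed

section \<open>Frobenius and the trace of a finite field extension\<close>

lemma power_CARD_eq:
  fixes x :: "'a::{field,finite}"
  shows "x ^ CARD('a) = x"
proof (cases "x = 0")
  case False
  let ?U = "UNIV - {0 :: 'a}"
  have "bij_betw ((*) x) ?U ?U"
    by (rule bij_betw_byWitness[where f' = "\<lambda>u. u / x"]) (use False in auto)
  then have "(\<Prod>u\<in>?U. x * u) = \<Prod>?U"
    using prod.reindex_bij_betw[of "(*) x" ?U ?U "\<lambda>u. u"] by simp
  then have "x ^ card ?U * \<Prod>?U = \<Prod>?U"
    by (simp add: prod.distrib)
  then have "x ^ card ?U = 1" by simp
  moreover have "CARD('a) = Suc (card ?U)"
    by (simp add: card_Diff_singleton)
  ultimately show ?thesis by (metis power_Suc mult.right_neutral)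
qed simp

locale finite_field_extension =
  fixes emb :: "'b::{field,finite} \<Rightarrow> 'f::{field,finite}"
  assumes embedding: "field_embedding emb"
begin

sublocale vs: vector_space "bscale emb"
  by (rule vector_space_bscale[OF embedding])

lemma emb_simps [simp]:
  "emb 1 = 1" "emb (x + y) = emb x + emb y" "emb (x * y) = emb x * emb y"
  "emb 0 = 0" "emb (- x) = - emb x" "emb (x - y) = emb x - emb y" "emb (x ^ n) = emb x ^ n"
proof -
  show 1: "emb 1 = 1" and 2: "emb (x + y) = emb x + emb y" "emb (x * y) = emb x * emb y" for x y
    using embedding by (auto simp: field_embedding_def)
  show 3: "emb 0 = 0" using 2(1)[of 0 0] unfolding add_0 by (metis add_cancel_left_right)
  show 4: "emb (- x) = - emb x" for x
    using 2(1)[of x "- x"] 3 by (simp add: eq_neg_iff_add_eq_0 add.commute)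
  show "emb (x - y) = emb x - emb y"
    using 2(1)[of x "- y"] 4[of y] by simp
  show "emb (x ^ n) = emb x ^ n" by (induction n) (auto simp: 1 2)
qed

lemma emb_eq_0_iff [simp]: "emb x = 0 \<longleftrightarrow> x = 0"
proof
  assume "emb x = 0"
  then have "emb (x * inverse x) = 0" by simp
  then show "x = 0" by (cases "x = 0") (simp_all del: emb_simps(3))
qed simp

lemma emb_eq_iff [simp]: "emb x = emb y \<longleftrightarrow> x = y"
  using emb_eq_0_iff[of "x - y"] by simp

lemma inj_emb: "inj emb" by (simp add: inj_def)

lemma card_range_emb: "card (range emb) = CARD('b)"
  by (rule card_image[OF inj_emb])

lemma CARD_ge_2: "CARD('b) \<ge> 2"
  using card_mono[of UNIV "{0, 1::'b}"] by simp

lemma CARD_eq_power: "CARD('f) = CARD('b) ^ ext_degree emb"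
  unfolding ext_degree_def by (rule vs.card_subspace) auto

text \<open>The polynomial \<open>(X + 1) ^ q - X ^ q - 1\<close> has degree less than \<open>q\<close> and vanishes on \<open>B\<close>.\<close>

lemma of_nat_CARD_choose:
  assumes "0 < i" "i < CARD('b)"
  shows "of_nat (CARD('b) choose i) = (0 :: 'f)"
proof -
  let ?q = "CARD('b)"
  define p :: "'f poly" where "p = (\<Sum>k\<in>{0<..<?q}. monom (of_nat (?q choose k)) k)"
  have q: "{..?q} = insert 0 (insert ?q {0<..<?q})" by auto
  have "poly p (emb b) = 0" for b
  proof -
    have "(b + 1) ^ ?q = b ^ ?q + 1" by (simp add: power_CARD_eq)
    then have "emb ((b + 1) ^ ?q) = emb (b ^ ?q + 1)" by simp
    then have "(emb b + 1) ^ ?q = emb b ^ ?q + 1" by simp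
    moreover have "(emb b + 1) ^ ?q = emb b ^ ?q + 1 + poly p (emb b)"
      unfolding binomial_ring p_def q by (simp add: poly_sum poly_monom)
    ultimately show ?thesis by simp
  qed
  then have "range emb \<subseteq> {x. poly p x = 0}" by auto
  then have le: "p \<noteq> 0 \<Longrightarrow> ?q \<le> degree p"
    using card_mono[of "{x. poly p x = 0}" "range emb"] card_poly_roots_bound[of p]
    by (simp add: card_range_emb)
  have "degree p \<le> ?q - 1"
    unfolding p_def by (rule degree_sum_le) (auto intro: order_trans[OF degree_monom_le])
  with le CARD_ge_2 have "p = 0" by fastforce
  moreover have "coeff p i = of_nat (?q choose i)"
    using assms by (simp add: p_def coeff_sum if_distrib sum.delta cong: if_cong)
  ultimately show ?thesis by simp
qed

lemma frobenius_add: "(x + y) ^ CARD('b) = x ^ CARD('b) + (y :: 'f) ^ CARD('b)"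
proof -
  let ?q = "CARD('b)"
  have q: "{..?q} = insert 0 (insert ?q {0<..<?q})" by auto
  show ?thesis
    unfolding binomial_ring q by (simp add: of_nat_CARD_choose)
qed

lemma frobenius_power_add:
  "(x + y) ^ (CARD('b) ^ i) = x ^ (CARD('b) ^ i) + (y :: 'f) ^ (CARD('b) ^ i)"
  by (induction i) (simp_all add: power_mult frobenius_add mult.commute[of "CARD('b)"])

lemma frobenius_sum: "(\<Sum>i\<in>I. (f i :: 'f)) ^ CARD('b) = (\<Sum>i\<in>I. f i ^ CARD('b))"
  by (induction I rule: infinite_finite_induct) (simp_all add: frobenius_add)

text \<open>X^q - X has at most q roots, and the q elements of the embedded B already exhaust
  them.\<close>

lemma frobenius_fixed_imp_in_range:
  assumes "x ^ CARD('b) = x"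
  shows "x \<in> range emb"
proof (rule ccontr)
  assume x: "x \<notin> range emb"
  let ?p = "monom 1 CARD('b) - monom 1 1 :: 'f poly"
  have deg: "degree ?p \<le> CARD('b)"
    by (intro degree_diff_le order_trans[OF degree_monom_le]) (use CARD_ge_2 in auto)
  have "coeff ?p CARD('b) = 1" using CARD_ge_2 by (simp add: coeff_monom)
  then have nz: "?p \<noteq> 0" by (metis coeff_0 zero_neq_one)
  have "emb b ^ CARD('b) = emb b" for b
    by (metis emb_simps(7) power_CARD_eq)
  then have "insert x (range emb) \<subseteq> {z. poly ?p z = 0}"
    using assms by (auto simp: poly_monom)
  then have "card (insert x (range emb)) \<le> degree ?p"
    by (intro order_trans[OF card_mono card_poly_roots_bound[OF nz]]) auto
  then show False using x deg by (simp add: card_range_emb)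
qed

text \<open>Raising to the power q shifts the conjugates cyclically because
  \<open>x ^ CARD('f) = x\<close>, so their sum is fixed by Frobenius and lies in the image of
  \<open>emb\<close>. Hence the \<open>THE\<close> in the trace is well defined.\<close>

lemma emb_field_trace: "emb (field_trace emb x) = (\<Sum>i<ext_degree emb. x ^ (CARD('b) ^ i))"
proof -
  let ?q = "CARD('b)" and ?n = "ext_degree emb"
  let ?t = "\<Sum>i<?n. x ^ (?q ^ i)"
  have "?t ^ ?q = (\<Sum>i<?n. x ^ (?q ^ Suc i))"
    by (simp add: frobenius_sum flip: power_mult) (simp add: mult.commute)
  also have "\<dots> = ?t"
    using sum.lessThan_Suc_shift[of "\<lambda>i. x ^ (?q ^ i)" ?n] power_CARD_eq[of x]
    by (simp add: CARD_eq_power)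
  finally obtain b where b: "?t = emb b"
    using frobenius_fixed_imp_in_range by blast
  show ?thesis
    unfolding field_trace_def b by simp
qed

lemma field_trace_add: "field_trace emb (x + y) = field_trace emb x + field_trace emb y"
proof -
  have "emb (field_trace emb (x + y)) = emb (field_trace emb x + field_trace emb y)"
    by (simp add: emb_field_trace frobenius_power_add sum.distrib del: emb_eq_iff)
  then show ?thesis by (simp only: emb_eq_iff)
qed

lemma field_trace_emb_mult: "field_trace emb (emb c * x) = c * field_trace emb x"
proof -
  have "c ^ (CARD('b) ^ i) = c" for i
  proof (induction i)
    case (Suc i)
    then show ?case
      by (simp only: power_Suc power_mult power_CARD_eq)
  qed simp
  then have c: "emb c ^ (CARD('b) ^ i) = emb c" for i
    by (metis emb_simps(7))
  have "emb (field_trace emb (emb c * x)) = emb (c * field_trace emb x)"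
    by (simp add: emb_field_trace power_mult_distrib c sum_distrib_left del: emb_eq_iff)
  then show ?thesis by (simp only: emb_eq_iff)
qed

lemma field_trace_mult_emb: "field_trace emb (h * (emb c * z)) = c * field_trace emb (h * z)"
  by (metis field_trace_emb_mult mult.left_commute)

lemma field_trace_0 [simp]: "field_trace emb 0 = 0"
  using field_trace_add[of 0 0] unfolding add_0 by (metis add_cancel_left_right)

lemma ext_degree_pos: "ext_degree emb > 0"
proof (rule ccontr)
  assume "\<not> ext_degree emb > 0"
  then have "CARD('f) = 1" by (simp add: CARD_eq_power)
  moreover have "card {0, 1 :: 'f} \<le> CARD('f)" by (rule card_mono) auto
  ultimately show False by simp
qed

text \<open>As a polynomial the trace has degree at most q^(n-1), where n is the extension degree;
  this is too small to vanish at all q^n elements of F.\<close>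

lemma field_trace_nonzero: "\<exists>x. field_trace emb x \<noteq> 0"
proof (rule ccontr)
  assume "\<not> ?thesis"
  then have 0: "(\<Sum>i<ext_degree emb. x ^ (CARD('b) ^ i)) = 0" for x :: 'f
    using emb_field_trace[of x] by simp
  let ?q = "CARD('b)" and ?n = "ext_degree emb"
  define p :: "'f poly" where "p = (\<Sum>i<?n. monom 1 (?q ^ i))"
  have inj: "?q ^ i = ?q ^ j \<longleftrightarrow> i = j" for i j
    using CARD_ge_2 by simp
  have "coeff p (?q ^ 0) = 1"
    unfolding p_def coeff_sum coeff_monom inj using ext_degree_pos by (simp add: sum.delta)
  then have nz: "p \<noteq> 0" by (metis coeff_0 zero_neq_one)
  have "degree p \<le> ?q ^ (?n - 1)"
    unfolding p_def
    by (intro degree_sum_le order_trans[OF degree_monom_le] power_increasing) auto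
  also have "\<dots> < ?q ^ ?n"
    using ext_degree_pos CARD_ge_2 by (intro power_strict_increasing) auto
  also have "\<dots> = card {x. poly p x = 0}"
    using 0 by (simp add: p_def poly_sum poly_monom CARD_eq_power)
  finally show False using card_poly_roots_bound[OF nz] by simp
qed

lemma field_trace_nondegenerate:
  assumes "\<And>h. field_trace emb (h * z) = 0"
  shows "z = 0"
proof (rule ccontr)
  assume "z \<noteq> 0"
  then have "field_trace emb x = 0" for x using assms[of "x / z"] by simp
  with field_trace_nonzero show False by blast
qed

section \<open>Trace duality: annihilators of subspaces\<close>

lemma card_subspace_eq_functional_kernel:
  assumes V: "vs.subspace V"
    and add: "\<And>x y. f (x + y) = f x + (f y :: 'b)" and scale: "\<And>c x. f (bscale emb c x) = c * f x"
    and nz: "x0 \<in> V" "f x0 \<noteq> 0"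
  shows "card V = CARD('b) * card {x \<in> V. f x = 0}"
proof -
  \<comment> \<open>A functional that is nonzero somewhere on \<open>V\<close> takes every value in
    B, so its kernel is one of q fibres of equal size.\<close>
  have "c \<in> f ` V" for c
  proof (rule image_eqI)
    show "bscale emb (c / f x0) x0 \<in> V" by (rule vs.subspace_scale[OF V nz(1)])
    show "c = f (bscale emb (c / f x0) x0)" using nz(2) by (simp add: scale)
  qed
  then have "f ` V = UNIV" by auto
  then show ?thesis
    using card_additive_image(2)[of V f] add vs.subspace_add[OF V] vs.subspace_diff[OF V] by simp
qed

lemma field_trace_mult_span_eq_0:
  assumes "\<And>h. h \<in> H \<Longrightarrow> field_trace emb (h * z) = 0" and "h \<in> vs.span H"
  shows "field_trace emb (h * z) = 0"
  using assms(2)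
proof (induction rule: vs.span_induct_alt)
  case base
  then show ?case by simp
next
  case (step c x y)
  then show ?case
    using assms(1) by (simp add: bscale_def distrib_right field_trace_add field_trace_emb_mult mult.assoc)
qed

text \<open>Double counting of the pairs \<open>(h, z)\<close> with \<open>h \<in> V\<close> and \<open>Tr(h z) = 0\<close>.\<close>

lemma card_subspace_times_card_trace_perp:
  assumes V: "vs.subspace V"
  shows "card V * card {z. \<forall>h\<in>V. field_trace emb (h * z) = 0} = CARD('f)"
proof -
  let ?q = "CARD('b)"
  let ?T = "\<lambda>h z. field_trace emb (h * z) = 0"
  define P where "P = {z. \<forall>h\<in>V. ?T h z}"
  have q: "?q \<ge> 2" by (rule CARD_ge_2)
  \<comment> \<open>The counts in \<open>row\<close> and \<open>col\<close> are multiplied by q, so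
    that a hyperplane contributes the size of the whole space and nothing is divided.\<close>
  have row: "?q * card {z. ?T h z} = (if h = 0 then ?q * CARD('f) else CARD('f))" for h
  proof (cases "h = 0")
    case False
    then obtain z where "field_trace emb (h * z) \<noteq> 0"
      using field_trace_nondegenerate[of h] by (metis mult.commute)
    then have "card (UNIV :: 'f set) = ?q * card {z \<in> UNIV. ?T h z}"
      by (intro card_subspace_eq_functional_kernel)
        (auto simp: distrib_left field_trace_add bscale_def field_trace_mult_emb)
    with False show ?thesis by simp
  qed simp
  have col: "?q * card {h \<in> V. ?T h z} = (if z \<in> P then ?q * card V else card V)" for z
  proof (cases "z \<in> P")
    case True
    then have "{h \<in> V. ?T h z} = V" by (auto simp: P_def)
    with True show ?thesis by simp
  next
    case False
    then obtain h where "h \<in> V" "field_trace emb (h * z) \<noteq> 0"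
      by (auto simp: P_def)
    then have "card V = ?q * card {h \<in> V. ?T h z}"
      by (intro card_subspace_eq_functional_kernel[OF V])
        (auto simp: distrib_right field_trace_add bscale_def mult.assoc field_trace_emb_mult)
    with False show ?thesis by simp
  qed
  have "(\<Sum>h\<in>V. card {z. ?T h z}) = (\<Sum>z\<in>UNIV. card {h \<in> V. ?T h z})"
    using sum_multicount_gen[of V UNIV ?T] by (auto simp: conj_commute)
  then have "(\<Sum>h\<in>V. ?q * card {z. ?T h z}) = (\<Sum>z\<in>UNIV. ?q * card {h \<in> V. ?T h z})"
    by (simp flip: sum_distrib_left)
  then have eq: "(\<Sum>h\<in>V. if h = 0 then ?q * CARD('f) else CARD('f))
      = (\<Sum>z\<in>UNIV. if z \<in> P then ?q * card V else card V)"
    unfolding row col .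
  have V0: "0 \<in> V" by (rule vs.subspace_0[OF V])
  have split: "(\<Sum>x\<in>X. if x \<in> Y then ?q * (c::nat) else c) = card X * c + card Y * ((?q - 1) * c)"
    if "Y \<subseteq> X" for X Y :: "'f set" and c
  proof -
    have "(\<Sum>x\<in>X. if x \<in> Y then ?q * c else c) = (\<Sum>x\<in>X. c + (if x \<in> Y then (?q - 1) * c else 0))"
      using q by (intro sum.cong refl) (auto simp: algebra_simps diff_mult_distrib)
    also have "\<dots> = card X * c + card Y * ((?q - 1) * c)"
      using that by (simp add: sum.distrib flip: sum.inter_filter) (simp add: Int_absorb1 flip: Int_def)
    finally show ?thesis .
  qed
  \<comment> \<open>Both sides of the double count contain |V| |F|, which cancels and leaves this
    multiple of the claim.\<close>
  have "(?q - 1) * (card V * card P) = (?q - 1) * CARD('f)"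
    using eq split[of "{0}" V "CARD('f)"] split[of P UNIV "card V"] V0 by (simp add: ac_simps)
  then show ?thesis using q by (simp add: P_def)
qed

section \<open>Independent families, ranks of repair matrices and the adjoint map\<close>

lemma card_span_indep_family:
  fixes v :: "'l::finite \<Rightarrow> 'f"
  assumes "indep_family emb v"
  shows "card (vs.span (v ` J)) = CARD('b) ^ card J"
proof -
  have "inj_on v J" "vs.independent (v ` J)"
    using assms vs.independent_mono[of "range v" "v ` J"]
    by (auto simp: indep_family_def intro: inj_on_subset)
  then show ?thesis
    using vs.card_span_independent[of "v ` J"] by (simp add: card_image)
qed

lemma is_basis_if_indep_family:
  fixes v :: "'l::finite \<Rightarrow> 'f"
  assumes "indep_family emb v" "CARD('l) = ext_degree emb"
  shows "is_basis emb v"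
proof -
  have "vs.span (range v) = UNIV"
    using card_span_indep_family[OF assms(1), of UNIV] assms(2) CARD_eq_power
    by (intro card_subset_eq) auto
  then show ?thesis using assms(1) by (simp add: is_basis_def)
qed

lemma field_trace_basis_eq_0:
  assumes "is_basis emb w" "\<And>j. field_trace emb (w j * z) = 0"
  shows "z = 0"
proof (rule field_trace_nondegenerate)
  show "field_trace emb (h * z) = 0" for h
    by (rule field_trace_mult_span_eq_0[of "range w"]) (use assms in \<open>auto simp: is_basis_def\<close>)
qed

text \<open>
  The rank is defined as the row rank, and the rows are the images of the evaluations
  \<open>g\<^sub>j(x)\<close> under the coordinate isomorphism \<open>h \<mapsto> (Tr(h \<beta>\<^sub>s))\<^sub>s\<close>.
\<close>

lemma power_rank_repair_matrix:
  fixes \<beta> :: "'l::finite \<Rightarrow> 'f"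
  assumes \<beta>: "is_basis emb \<beta>"
  shows "CARD('b) ^ rank (repair_matrix emb \<beta> g x) = card (vs.span (range (\<lambda>j. poly (g j) x)))"
proof -
  define \<Psi> :: "'f \<Rightarrow> 'b^'l" where "\<Psi> h = (\<chi> s. field_trace emb (h * \<beta> s))" for h
  let ?H = "range (\<lambda>j. poly (g j) x)"
  interpret \<Psi>: Vector_Spaces.linear "bscale emb" "(*s)" \<Psi>
    by unfold_locales
      (simp_all add: \<Psi>_def vec_eq_iff distrib_right field_trace_add bscale_def mult.assoc field_trace_emb_mult)
  have "inj \<Psi>"
    unfolding \<Psi>.inj_iff_eq_0 using field_trace_basis_eq_0[OF \<beta>]
    by (auto simp: \<Psi>_def vec_eq_iff mult.commute)
  have "rows (repair_matrix emb \<beta> g x) = \<Psi> ` ?H"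
    by (auto simp: rows_def row_def repair_matrix_def \<Psi>_def)
  then have "vec.span (rows (repair_matrix emb \<beta> g x)) = \<Psi> ` vs.span ?H"
    by (simp add: \<Psi>.span_image)
  moreover have "card (vec.span (rows (repair_matrix emb \<beta> g x))) = CARD('b) ^ rank (repair_matrix emb \<beta> g x)"
    unfolding row_rank_def_gen by (subst vec.card_subspace) (auto simp: vec.dim_span)
  ultimately show ?thesis
    using \<open>inj \<Psi>\<close> by (metis card_image inj_on_subset top_greatest)
qed

text \<open>An annihilator of the evaluations annihilates their span, whose size is q to the rank;
  trace duality then gives the size of the annihilator.\<close>

lemma power_rank_times_card_perp:
  fixes \<beta> :: "'l::finite \<Rightarrow> 'f"
  assumes "is_basis emb \<beta>"
  shows "CARD('b) ^ rank (repair_matrix emb \<beta> g x) * card {z. \<forall>j. field_trace emb (poly (g j) x * z) = 0} = CARD('f)"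
proof -
  let ?H = "range (\<lambda>j. poly (g j) x)"
  have "{z. \<forall>h\<in>vs.span ?H. field_trace emb (h * z) = 0} = {z. \<forall>j. field_trace emb (poly (g j) x * z) = 0}"
    using field_trace_mult_span_eq_0[of ?H] vs.span_base[of _ ?H] by blast
  then show ?thesis
    using card_subspace_times_card_trace_perp[of "vs.span ?H"] assms
    by (simp add: power_rank_repair_matrix)
qed

text \<open>\<open>S\<close> is the negated trace adjoint of the \<open>B\<close>-linear map \<open>w\<^sub>j \<mapsto> v\<^sub>j\<close>.\<close>

lemma exists_adjoint:
  fixes w v :: "'l::finite \<Rightarrow> 'f"
  assumes w: "is_basis emb w" and l: "CARD('l) = ext_degree emb"
  obtains S where "\<And>x y. S (x + y) = S x + S y" "\<And>c x. S (emb c * x) = emb c * S x"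
    "\<And>y z. (\<forall>j. field_trace emb ((w j + y * v j) * z) = 0) \<longleftrightarrow> S (y * z) = z"
proof -
  define \<Phi> :: "'f \<Rightarrow> 'l \<Rightarrow> 'b" where "\<Phi> z = (\<lambda>j. field_trace emb (w j * z))" for z
  have "inj \<Phi>"
  proof (rule injI)
    fix x y assume "\<Phi> x = \<Phi> y"
    then have "field_trace emb (w j * (x - y)) = 0" for j
      using field_trace_add[of "w j * (x - y)" "w j * y"]
      by (auto simp: \<Phi>_def fun_eq_iff algebra_simps)
    then show "x = y" using field_trace_basis_eq_0[OF w] by fastforce
  qed
  moreover have "CARD('f) = CARD('l \<Rightarrow> 'b)"
    by (simp add: card_fun CARD_eq_power l ext_degree_pos)
  ultimately have "surj \<Phi>"
    by (metis card_image card_subset_eq finite subset_UNIV)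
  \<comment> \<open>\<open>\<Phi>\<close> is bijective, so \<open>S z\<close> is the unique vector
    with Tr(w_j S(z)) = -Tr(v_j z) for all j. Hence Tr((w_j + y v_j) z) is the difference of the
    j-th coordinates of \<open>\<Phi> z\<close> and \<open>\<Phi> (S (y * z))\<close>.\<close>
  define S where "S z = inv \<Phi> (\<lambda>j. - field_trace emb (v j * z))" for z
  have \<Phi>S: "\<Phi> (S z) = (\<lambda>j. - field_trace emb (v j * z))" for z
    unfolding S_def using \<open>surj \<Phi>\<close> by (simp add: surj_f_inv_f)
  have \<Phi>_add: "\<Phi> (x + y) = (\<lambda>j. \<Phi> x j + \<Phi> y j)" for x y
    by (simp add: \<Phi>_def distrib_left field_trace_add)
  have \<Phi>_scale: "\<Phi> (emb c * x) = (\<lambda>j. c * \<Phi> x j)" for c x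
    by (simp add: \<Phi>_def field_trace_mult_emb)
  show thesis
  proof
    show "S (x + y) = S x + S y" for x y
      by (rule injD[OF \<open>inj \<Phi>\<close>])
        (simp add: \<Phi>S \<Phi>_add distrib_left field_trace_add)
    show "S (emb c * x) = emb c * S x" for c x
      by (rule injD[OF \<open>inj \<Phi>\<close>])
        (simp add: \<Phi>S \<Phi>_scale field_trace_mult_emb)
    show "(\<forall>j. field_trace emb ((w j + y * v j) * z) = 0) \<longleftrightarrow> S (y * z) = z" for y z
    proof -
      have "S (y * z) = z \<longleftrightarrow> \<Phi> (S (y * z)) = \<Phi> z"
        using \<open>inj \<Phi>\<close> by (simp add: inj_eq)
      also have "\<dots> \<longleftrightarrow> (\<forall>j. \<Phi> z j + field_trace emb (v j * (y * z)) = 0)"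
        unfolding \<Phi>S fun_eq_iff by (metis add_eq_0_iff add.commute)
      finally show ?thesis
        by (simp add: \<Phi>_def algebra_simps field_trace_add)
    qed
  qed
qed

end

text \<open>Here \<open>m\<close> will be l - d + 1 and \<open>k\<close> the shortfall of a
  dimension from d - 1. For k = 1 the inequality says m (q - 1) \<le> 1; for k \<ge> 2 it fails
  because q^k \<ge> k + 2. The second alternative is the source of the exceptional binary
  case.\<close>

lemma mult_power_le_add_cases:
  fixes m q k :: nat
  assumes "m \<ge> 1" "q \<ge> 2" "m * q ^ k \<le> m + k"
  shows "k = 0 \<or> k = 1 \<and> q = 2 \<and> m = 1"
proof -
  consider "k = 0" | "k = 1" | "k \<ge> 2" by linarith
  then show ?thesis
  proof cases
    case 2
    obtain m' q' where m: "m = Suc m'" and q: "q = Suc (Suc q')"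
      using assms(1,2) by (metis Suc_le_D numeral_2_eq_2 One_nat_def Suc_le_mono)
    show ?thesis using assms(3) 2 by (simp add: m q)
  next
    case 3
    have "k + 2 \<le> 2 ^ k"
      using 3 by (induction k rule: dec_induct) auto
    also have "\<dots> \<le> q ^ k" using assms(2) by (rule power_mono) simp
    finally have "m * (k + 2) \<le> m * q ^ k" by (rule mult_le_mono2)
    moreover have "k \<le> m * k" using assms(1) by simp
    ultimately have False using assms(1,3) unfolding distrib_left by linarith
    then show ?thesis ..
  qed simp
qed

context finite_field_extension
begin

lemma indep_family_sum_eq_0:
  fixes v :: "'l::finite \<Rightarrow> 'f"
  assumes v: "indep_family emb v" and 0: "(\<Sum>s\<in>J. emb (c s) * v s) = 0" and s: "s \<in> J"
  shows "c s = 0"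
proof -
  have inj: "inj v" and ind: "vs.independent (v ` J)"
    using v vs.independent_mono[of "range v" "v ` J"] by (auto simp: indep_family_def)
  have "(\<Sum>x\<in>v ` J. bscale emb (c (inv v x)) x) = 0"
    using 0 inj by (subst sum.reindex) (auto simp: bscale_def intro: inj_on_subset)
  then have "c (inv v (v s)) = 0"
    using vs.independentD[OF ind _ subset_refl, of "\<lambda>x. c (inv v x)" "v s"] s by auto
  with inj show ?thesis by simp
qed

lemma span_indep_familyE:
  fixes v :: "'l::finite \<Rightarrow> 'f"
  assumes v: "indep_family emb v" and z: "z \<in> vs.span (v ` J)"
  obtains c where "z = (\<Sum>s\<in>J. emb (c s) * v s)"
proof -
  have "inj_on v J" using v by (auto simp: indep_family_def intro: inj_on_subset)
  moreover obtain u where "z = (\<Sum>x\<in>v ` J. bscale emb (u x) x)"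
    using z by (auto simp: vs.span_finite)
  ultimately have "z = (\<Sum>s\<in>J. emb (u (v s)) * v s)"
    by (simp add: sum.reindex bscale_def)
  then show thesis by (rule that)
qed

end

section \<open>Fixed points of the maps z \<mapsto> S(y z)\<close>

locale linear_fixed_points = finite_field_extension emb
  for emb :: "'b::{field,finite} \<Rightarrow> 'f::{field,finite}" +
  fixes S :: "'f \<Rightarrow> 'f" and A :: "'f set" and d :: nat
  assumes S_add: "S (x + y) = S x + S y"
    and S_emb: "S (emb c * x) = emb c * S x"
    and subspace_A: "vs.subspace A" and dim_A: "vs.dim A = d"
begin

lemma S_0 [simp]: "S 0 = 0"
  using S_add[of 0 0] unfolding add_0 by (metis add_cancel_left_right)

lemma S_sum: "S (\<Sum>i\<in>I. f i) = (\<Sum>i\<in>I. S (f i))"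
  by (induction I rule: infinite_finite_induct) (simp_all add: S_add)

definition kernel :: "'f set" where "kernel = {x. S x = 0}"

text \<open>The space K_y. When \<open>S\<close> comes from a repair scheme, its codimension is the
  rank of the repair matrix at the node a + y.\<close>

definition fixed :: "'f \<Rightarrow> 'f set" where "fixed y = {z. S (y * z) = z}"

lemma card_A: "card A = CARD('b) ^ d"
  using vs.card_subspace[OF _ _ subspace_A] by (simp add: dim_A)

lemma d_le: "d \<le> ext_degree emb"
proof -
  have "CARD('b) ^ d \<le> CARD('b) ^ ext_degree emb"
    unfolding card_A[symmetric] CARD_eq_power[symmetric] by (rule card_mono) auto
  then show ?thesis using CARD_ge_2 by simp
qed

lemma subspace_range: "vs.subspace (range S)"
proof (rule vs.subspaceI)
  show "0 \<in> range S" using S_0 by (metis rangeI)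
  show "x + y \<in> range S" if "x \<in> range S" "y \<in> range S" for x y
    using that by (auto simp flip: S_add)
  show "bscale emb c x \<in> range S" if "x \<in> range S" for c x
    using that by (auto simp: bscale_def simp flip: S_emb)
qed

lemma card_range_times_kernel: "card (range S) * card kernel = CARD('b) ^ ext_degree emb"
  using card_additive_image(2)[of UNIV S] S_add by (simp add: kernel_def CARD_eq_power)

lemma card_fibre: "z \<in> range S \<Longrightarrow> card {x. S x = z} = card kernel"
  using card_additive_image(1)[of UNIV S z] S_add by (simp add: kernel_def)

lemma subspace_fixed: "vs.subspace (fixed y)"
  by (rule vs.subspaceI) (auto simp: fixed_def S_add S_emb bscale_def distrib_left mult.left_commute[of y])

text \<open>S(y z) = z scales to S(c y z) = c z, so y \<mapsto> S(y z) maps A onto a set containing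
  the whole line B z.\<close>

lemma range_emb_mult_subset:
  assumes "y \<in> A" "z \<in> fixed y"
  shows "range (\<lambda>c. emb c * z) \<subseteq> (\<lambda>y. S (y * z)) ` A"
proof
  fix x assume "x \<in> range (\<lambda>c. emb c * z)"
  then obtain c where x: "x = emb c * z" by auto
  show "x \<in> (\<lambda>y. S (y * z)) ` A"
  proof (rule image_eqI)
    show "bscale emb c y \<in> A" using vs.subspace_scale[OF subspace_A assms(1)] .
    show "x = S (bscale emb c y * z)"
      using assms(2) by (simp add: x fixed_def bscale_def mult.assoc S_emb)
  qed
qed

lemma card_range_emb_mult: "z \<noteq> 0 \<Longrightarrow> card (range (\<lambda>c. emb c * z)) = CARD('b)"
  by (rule card_image) (auto intro: injI)

text \<open>The y in A that fix z form the fibre over z of the B-linear map y \<mapsto> S(y z) on A,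
  hence a coset of its kernel, of dimension \<open>e\<close>. The image contains the line B z, which
  gives e < d; multiplication by z embeds the kernel into ker S.\<close>

lemma card_fixing:
  assumes "y0 \<in> A" "z \<in> fixed y0" "z \<noteq> 0"
  obtains e where "card {y \<in> A. z \<in> fixed y} = CARD('b) ^ e" "e < d" "CARD('b) ^ e \<le> card kernel"
    "card ((\<lambda>y. S (y * z)) ` A) * CARD('b) ^ e = CARD('b) ^ d"
proof -
  let ?h = "\<lambda>y. S (y * z)"
  let ?K = "{y \<in> A. ?h y = 0}"
  have add: "?h (x + y) = ?h x + ?h y" for x y by (simp add: distrib_right S_add)
  have "vs.subspace ?K"
    using vs.subspace_0[OF subspace_A] vs.subspace_add[OF subspace_A] vs.subspace_scale[OF subspace_A]
    by (intro vs.subspaceI) (auto simp: distrib_right S_add bscale_def mult.assoc S_emb)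
  then have K: "card ?K = CARD('b) ^ vs.dim ?K" by (intro vs.card_subspace) auto
  have "z \<in> ?h ` A" using assms by (force simp: fixed_def)
  then have 1: "card {y \<in> A. z \<in> fixed y} = card ?K"
    using card_additive_image(1)[of A ?h z] add vs.subspace_add[OF subspace_A] vs.subspace_diff[OF subspace_A]
    by (simp add: fixed_def)
  have 2: "CARD('b) ^ d = card (?h ` A) * card ?K"
    using card_additive_image(2)[of A ?h] add vs.subspace_add[OF subspace_A] vs.subspace_diff[OF subspace_A]
    by (simp add: card_A)
  have "CARD('b) \<le> card (?h ` A)"
    using card_mono[OF _ range_emb_mult_subset[OF assms(1,2)]] by (simp add: card_range_emb_mult assms(3))
  then have "CARD('b) * CARD('b) ^ vs.dim ?K \<le> CARD('b) ^ d"
    unfolding 2 K by simp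
  then have "CARD('b) ^ Suc (vs.dim ?K) \<le> CARD('b) ^ d" by simp
  then have 3: "vs.dim ?K < d"
    using CARD_ge_2 by (subst (asm) power_increasing_iff) auto
  have "card ?K = card ((\<lambda>y. y * z) ` ?K)"
    using assms(3) by (intro card_image[symmetric] inj_onI) auto
  also have "\<dots> \<le> card kernel" by (rule card_mono) (auto simp: kernel_def)
  finally show thesis using that[of "vs.dim ?K"] 1 2 3 K by simp
qed

text \<open>Only nonzero \<open>z\<close> in the range of \<open>S\<close> have fixing \<open>y\<close>, at most \<open>|ker S|\<close> each.\<close>

lemma sum_card_fixed_le: "(\<Sum>y\<in>A. card (fixed y) - 1) + card kernel \<le> CARD('b) ^ ext_degree emb"
proof -
  have card: "card (fixed y) - 1 = card {z. z \<noteq> 0 \<and> z \<in> fixed y}" for y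
  proof -
    have "{z. z \<noteq> 0 \<and> z \<in> fixed y} = fixed y - {0}" by auto
    moreover have "0 \<in> fixed y" by (simp add: fixed_def)
    ultimately show ?thesis by simp
  qed
  have "(\<Sum>y\<in>A. card (fixed y) - 1) = (\<Sum>z\<in>-{0}. card {y \<in> A. z \<in> fixed y})"
    unfolding card using sum_multicount_gen[of A "-{0}" "\<lambda>y z. z \<in> fixed y"] by auto
  also have "\<dots> \<le> (\<Sum>z\<in>-{0}. if z \<in> range S then card kernel else 0)"
  proof (rule sum_mono)
    fix z assume z: "z \<in> - {0 :: 'f}"
    show "card {y \<in> A. z \<in> fixed y} \<le> (if z \<in> range S then card kernel else 0)"
    proof (cases "z \<in> range S")
      case True
      have "card {y \<in> A. z \<in> fixed y} = card ((\<lambda>y. y * z) ` {y \<in> A. z \<in> fixed y})"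
        using z by (intro card_image[symmetric] inj_onI) auto
      also have "\<dots> \<le> card {x. S x = z}" by (rule card_mono) (auto simp: fixed_def)
      finally show ?thesis using True by (simp add: card_fibre)
    next
      case False
      then have "z \<notin> fixed y" for y
        unfolding fixed_def by (metis (mono_tags) mem_Collect_eq rangeI)
      then show ?thesis by simp
    qed
  qed
  also have "\<dots> = card (range S - {0}) * card kernel"
    by (simp add: Int_def Diff_eq conj_commute flip: sum.inter_filter)
  also have "\<dots> = (card (range S) - 1) * card kernel"
    using vs.subspace_0[OF subspace_range] by simp
  \<comment> \<open>Adding |ker S| restores the term z = 0 and completes the product of the sizes of
    range and kernel.\<close>
  finally have "(\<Sum>y\<in>A. card (fixed y) - 1) + card kernel \<le> (card (range S) - 1 + 1) * card kernel"
    by simp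
  moreover have "card (range S) \<ge> 1" by (simp add: Suc_le_eq card_gt_0_iff)
  ultimately show ?thesis by (simp add: card_range_times_kernel)
qed

text \<open>\<open>total\<close> is the number of zero columns forced by I/O-optimality. Bounding it
  by the number of occurring \<beta>_s times the largest fixing set, and that number by dim range S,
  leaves almost no slack: either all bounds are attained, or the largest fixing set falls one
  dimension short, which forces q = 2 and d = l.\<close>

lemma fixed_basis_dichotomy:
  fixes \<beta> :: "'l::finite \<Rightarrow> 'f"
  assumes \<beta>: "is_basis emb \<beta>" and d: "d \<ge> 1"
    and total: "(\<Sum>s\<in>UNIV. card {y \<in> A. \<beta> s \<in> fixed y}) = (ext_degree emb + 1 - d) * CARD('b) ^ (d - 1)"
  shows "CARD('b) ^ (d - 1) \<le> card kernel \<and> (\<forall>y\<in>A. card (fixed y) = CARD('b) ^ card {s. \<beta> s \<in> fixed y})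
    \<or> d = ext_degree emb \<and> CARD('b) = 2 \<and> 2 ^ (ext_degree emb - 2) \<le> card kernel"
proof -
  define N where "N s = card {y \<in> A. \<beta> s \<in> fixed y}" for s
  define Z where "Z = {s. N s > 0}"
  have ind: "indep_family emb \<beta>" using \<beta> by (simp add: is_basis_def)
  have \<beta>0: "\<beta> s \<noteq> 0" for s
    using indep_family_sum_eq_0[OF ind, of "\<lambda>_. 1" "{s}" s] by auto
  have Zy: "\<exists>y\<in>A. \<beta> s \<in> fixed y" if "s \<in> Z" for s
    using that by (auto simp: Z_def N_def card_gt_0_iff)
  have "\<forall>s\<in>Z. \<exists>e. N s = CARD('b) ^ e \<and> e < d \<and> CARD('b) ^ e \<le> card kernel
      \<and> card ((\<lambda>y. S (y * \<beta> s)) ` A) * CARD('b) ^ e = CARD('b) ^ d"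
  proof
    fix s assume "s \<in> Z"
    then obtain y where "y \<in> A" "\<beta> s \<in> fixed y" using Zy by blast
    from card_fixing[OF this \<beta>0] show "\<exists>e. N s = CARD('b) ^ e \<and> e < d \<and> CARD('b) ^ e \<le> card kernel
      \<and> card ((\<lambda>y. S (y * \<beta> s)) ` A) * CARD('b) ^ e = CARD('b) ^ d"
      unfolding N_def by blast
  qed
  from bchoice[OF this] obtain e where e: "\<And>s. s \<in> Z \<Longrightarrow> N s = CARD('b) ^ e s" "\<And>s. s \<in> Z \<Longrightarrow> e s < d"
    "\<And>s. s \<in> Z \<Longrightarrow> CARD('b) ^ e s \<le> card kernel"
    "\<And>s. s \<in> Z \<Longrightarrow> card ((\<lambda>y. S (y * \<beta> s)) ` A) * CARD('b) ^ e s = CARD('b) ^ d"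
    by blast
  have span_le: "vs.span (\<beta> ` Z) \<subseteq> range S"
  proof (rule vs.span_minimal[OF _ subspace_range])
    show "\<beta> ` Z \<subseteq> range S" using Zy by (auto simp: fixed_def) (metis rangeI)
  qed
  have card_span: "card (vs.span (\<beta> ` Z)) = CARD('b) ^ card Z"
    by (rule card_span_indep_family[OF ind])
  then have Z_le: "CARD('b) ^ card Z \<le> card (range S)"
    using card_mono[OF _ span_le] by simp
  have totalN: "(\<Sum>s\<in>Z. N s) = (ext_degree emb + 1 - d) * CARD('b) ^ (d - 1)"
    unfolding total[symmetric] N_def[symmetric] by (rule sum.mono_neutral_left) (auto simp: Z_def)
  have "Z \<noteq> {}"
    using totalN d_le by auto
  define E where "E = Max (e ` Z)"
  have "E \<in> e ` Z"
    unfolding E_def using \<open>Z \<noteq> {}\<close> by (intro Max_in) auto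
  then obtain s0 where s0: "s0 \<in> Z" "e s0 = E" by auto
  have E: "E < d" "CARD('b) ^ E \<le> card kernel" using e(2,3)[OF s0(1)] s0(2) by auto
  have eE: "e s \<le> E" if "s \<in> Z" for s using that by (simp add: E_def)
  \<comment> \<open>The occurring \<beta>_s are independent vectors of range S, and E \<le> dim ker
    S, so rank-nullity bounds |Z| + E.\<close>
  have "CARD('b) ^ (card Z + E) \<le> CARD('b) ^ ext_degree emb"
    unfolding power_add card_range_times_kernel[symmetric] by (rule mult_mono[OF Z_le E(2)]) auto
  then have ZE: "card Z + E \<le> ext_degree emb"
    using CARD_ge_2 by simp
  \<comment> \<open>\<open>k\<close> is the shortfall of \<open>E\<close> from its maximum d - 1.
    The total will give (l + 1 - d) q^k \<le> |Z|, and rank-nullity |Z| \<le> l + 1 - d + k.\<close>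
  define k where "k = d - 1 - E"
  have dk: "d - 1 = E + k" using E by (simp add: k_def)
  have N_le: "N s \<le> CARD('b) ^ E" if "s \<in> Z" for s
    unfolding e(1)[OF that] using eE[OF that] CARD_ge_2 by (intro power_increasing) auto
  have up: "(ext_degree emb + 1 - d) * CARD('b) ^ (d - 1) \<le> card Z * CARD('b) ^ E"
    unfolding totalN[symmetric] using sum_bounded_above[of Z N] N_le by simp
  then have "((ext_degree emb + 1 - d) * CARD('b) ^ k) * CARD('b) ^ E \<le> card Z * CARD('b) ^ E"
    unfolding dk by (simp add: power_add ac_simps)
  then have "(ext_degree emb + 1 - d) * CARD('b) ^ k \<le> card Z"
    using CARD_ge_2 by simp
  moreover have "card Z \<le> ext_degree emb + 1 - d + k"
    using ZE dk d d_le by linarith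
  ultimately have "k = 0 \<or> k = 1 \<and> CARD('b) = 2 \<and> ext_degree emb + 1 - d = 1"
    using d_le CARD_ge_2 by (intro mult_power_le_add_cases) auto
  then show ?thesis
  proof
    assume "k = 1 \<and> CARD('b) = 2 \<and> ext_degree emb + 1 - d = 1"
    then have "d = ext_degree emb" "CARD('b) = 2" "E = ext_degree emb - 2" using d_le dk by auto
    then show ?thesis using E(2) by simp
  next
    assume "k = 0"
    then have Ed: "E = d - 1" using dk by simp
    have cardZ: "card Z = ext_degree emb + 1 - d"
    proof (rule antisym)
      show "card Z \<le> ext_degree emb + 1 - d" using ZE Ed d d_le by linarith
      show "ext_degree emb + 1 - d \<le> card Z" using up CARD_ge_2 by (simp add: Ed)
    qed
    \<comment> \<open>|Z| terms, none above q^(d-1), add up to |Z| q^(d-1), so each attains the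
      maximum.\<close>
    have eq: "e s = d - 1" if s: "s \<in> Z" for s
    proof (rule ccontr)
      assume ne: "e s \<noteq> d - 1"
      have "CARD('b) ^ e s < CARD('b) ^ (d - 1)"
        using e(2)[OF s] ne CARD_ge_2 by (intro power_strict_increasing) auto
      then have "N s < CARD('b) ^ (d - 1)" using e(1)[OF s] by simp
      then have "(\<Sum>s\<in>Z. N s) < (\<Sum>s\<in>Z. CARD('b) ^ (d - 1))"
        using s N_le by (intro sum_strict_mono_ex1) (auto simp: Ed)
      then show False using totalN cardZ by simp
    qed
    \<comment> \<open>The kernel has at least q^(d-1) elements, so the range has at most q^|Z|, the
      size of the span it contains.\<close>
    have range_eq: "range S = vs.span (\<beta> ` Z)"
    proof (rule card_subset_eq[symmetric, OF _ span_le])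
      have "card (range S) * CARD('b) ^ (d - 1) \<le> card (range S) * card kernel"
        using E(2) Ed by simp
      also have "\<dots> = CARD('b) ^ card Z * CARD('b) ^ (d - 1)"
        using card_range_times_kernel cardZ d d_le by (simp flip: power_add)
      finally have "card (range S) \<le> CARD('b) ^ card Z" using CARD_ge_2 by simp
      with Z_le card_span show "card (vs.span (\<beta> ` Z)) = card (range S)" by simp
    qed simp
    \<comment> \<open>The kernel of y \<mapsto> S(y \<beta>_s) on A has q^(d-1) elements, so the
      image has q elements and equals the line it contains.\<close>
    have line: "(\<lambda>y. S (y * \<beta> s)) ` A = range (\<lambda>c. emb c * \<beta> s)" if s: "s \<in> Z" for s
    proof -
      have "card ((\<lambda>y. S (y * \<beta> s)) ` A) * CARD('b) ^ (d - 1) = CARD('b) * CARD('b) ^ (d - 1)"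
        using e(4)[OF s] eq[OF s] d by (simp flip: power_Suc)
      then have "card ((\<lambda>y. S (y * \<beta> s)) ` A) = CARD('b)" using CARD_ge_2 by simp
      moreover obtain y where "y \<in> A" "\<beta> s \<in> fixed y" using Zy[OF s] by blast
      ultimately show ?thesis
        using range_emb_mult_subset card_range_emb_mult[OF \<beta>0]
        by (intro card_subset_eq[symmetric]) auto
    qed
    \<comment> \<open>The \<beta>_s with s in \<open>Z\<close> are common eigenvectors of the maps z
      \<mapsto> S(y z), y in A, and span range S, which contains every fixed vector. By comparison
      of coefficients, a fixed vector involves only those with eigenvalue 1, that is, those in
      \<open>fixed y\<close>.\<close>
    have "card (fixed y) = CARD('b) ^ card {s. \<beta> s \<in> fixed y}" if y: "y \<in> A" for y
    proof -
      have "\<exists>f. S (y * \<beta> s) = emb f * \<beta> s" if "s \<in> Z" for s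
        using line[OF that] y by (metis (mono_tags, lifting) imageE imageI)
      then obtain f where f: "\<And>s. s \<in> Z \<Longrightarrow> S (y * \<beta> s) = emb (f s) * \<beta> s" by metis
      have "fixed y \<subseteq> vs.span (\<beta> ` {s. \<beta> s \<in> fixed y})"
      proof
        fix z assume z: "z \<in> fixed y"
        then have "z \<in> range S" unfolding fixed_def by (metis (mono_tags) mem_Collect_eq rangeI)
        then obtain c where c: "z = (\<Sum>s\<in>Z. emb (c s) * \<beta> s)"
          using span_indep_familyE[OF ind] unfolding range_eq by blast
        have "S (y * z) = (\<Sum>s\<in>Z. S (emb (c s) * (y * \<beta> s)))"
          by (simp add: c sum_distrib_left S_sum mult.left_commute)
        also have "\<dots> = (\<Sum>s\<in>Z. emb (c s) * (emb (f s) * \<beta> s))"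
          using f by (simp add: S_emb)
        finally have "(\<Sum>s\<in>Z. emb (c s * (f s - 1)) * \<beta> s) = 0"
          using z c by (simp add: fixed_def algebra_simps sum_subtractf)
        then have cf: "c s * (f s - 1) = 0" if "s \<in> Z" for s
          using indep_family_sum_eq_0[OF ind, of "\<lambda>s. c s * (f s - 1)" Z s] that by blast
        have "emb (c s) * \<beta> s \<in> vs.span (\<beta> ` {s. \<beta> s \<in> fixed y})" if s: "s \<in> Z" for s
        proof (cases "c s = 0")
          case True
          then show ?thesis by (simp add: vs.span_zero)
        next
          case False
          then have "f s = 1" using cf[OF s] by simp
          then have "\<beta> s \<in> fixed y" using f[OF s] by (simp add: fixed_def)
          then show ?thesis
            using vs.span_scale[OF vs.span_base] by (metis (mono_tags) bscale_def imageI mem_Collect_eq)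
        qed
        then show "z \<in> vs.span (\<beta> ` {s. \<beta> s \<in> fixed y})"
          unfolding c by (rule vs.span_sum)
      qed
      moreover have "vs.span (\<beta> ` {s. \<beta> s \<in> fixed y}) \<subseteq> fixed y"
        by (rule vs.span_minimal[OF _ subspace_fixed]) auto
      ultimately have "fixed y = vs.span (\<beta> ` {s. \<beta> s \<in> fixed y})" by blast
      then show ?thesis using card_span_indep_family[OF ind] by metis
    qed
    then show ?thesis using E(2) Ed by simp
  qed
qed

end

section \<open>Final estimates and the translation of repair schemes\<close>

lemma bandwidth_bound_arith:
  fixes q d l :: nat
  assumes d: "1 \<le> d" "d < l" and q: "q \<ge> 2" "3 \<le> q ^ d"
  shows "(real q ^ d - 1) * real l - (real l - real d + 1) * real q ^ (d - 1)
    \<ge> (real q ^ d - 1) * real d - real q powi (2 * int d - int l - 1)"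
proof -
  define k where "k = l - d"
  define Q where "Q = real q ^ (d - 1)"
  define R where "R = real q powi (2 * int d - int l - 1)"
  have k: "k \<ge> 1" and l: "real l = real d + real k" using d by (auto simp: k_def)
  have qd: "real q ^ d = real q * Q" using d(1) unfolding Q_def by (cases d) auto
  have R: "R > 0" using q by (simp add: R_def)
  have q2: "real q \<ge> 2" using q by simp
  \<comment> \<open>This is the claim rearranged. Positivity of \<open>R\<close> suffices for d = 1,
    where q \<ge> 3, and for k \<ge> 2. For k = 1 the exact value R = P = q^(d-2) turns it into P (q
    - 1)^2 \<ge> 1.\<close>
  have "(real q * Q - 1) * real k + R \<ge> (real k + 1) * Q"
  proof (cases "d = 1")
    case True
    then have Q: "Q = 1" and "real q \<ge> 3" using q(2) by (auto simp: Q_def)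
    then have "real q * real k \<ge> 3 * real k"
      by (intro mult_right_mono) auto
    moreover have "real k \<ge> 1" using k by simp
    ultimately have "real q * real k - real k + R \<ge> real k + 1" using R by linarith
    then show ?thesis by (simp add: Q left_diff_distrib)
  next
    case False
    define e where "e = d - 2"
    with False d(1) have e: "d = Suc (Suc e)" by simp
    define P where "P = real q ^ e"
    have P: "P \<ge> 1" and Q: "Q = real q * P" using q2 by (auto simp: P_def Q_def e)
    show ?thesis
    proof (cases "k = 1")
      case True
      then have "2 * int d - int l - 1 = int e" using d by (simp add: k_def e)
      then have "R = P" by (simp add: R_def P_def)
      moreover have "P * (real q - 1)\<^sup>2 \<ge> 1 * 1"
        using P q2 by (intro mult_mono one_le_power) auto
      ultimately show ?thesis
        using True by (simp add: Q algebra_simps power2_eq_square)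
    next
      case False
      then have k2: "real k \<ge> 2" using k by simp
      have "1 * 2 \<le> P * real q" using P q2 by (intro mult_mono) auto
      then have Q2: "Q \<ge> 2" by (simp add: Q mult.commute)
      have "(Q - 1) * (real k - 1) \<ge> 1 * 1" using Q2 k2 by (intro mult_mono) auto
      moreover have "2 * Q * real k \<le> real q * Q * real k"
        using q2 Q2 by (intro mult_right_mono) auto
      ultimately show ?thesis using R by (simp add: algebra_simps)
    qed
  qed
  then show ?thesis
    unfolding R_def[symmetric] Q_def[symmetric] qd l by (simp add: algebra_simps)
qed

lemma poly_eq_if_degree_le_1:
  fixes p :: "'a::comm_ring_1 poly"
  assumes "degree p \<le> 1"
  shows "poly p x = poly p a + (x - a) * coeff p 1"
proof -
  have "p = [:coeff p 0, coeff p 1:]"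
    using assms by (intro poly_eqI) (auto simp: coeff_pCons coeff_eq_0 split: nat.splits)
  then obtain c\<^sub>0 c\<^sub>1 where "p = [:c\<^sub>0, c\<^sub>1:]" by blast
  then show ?thesis by (simp add: algebra_simps)
qed

text \<open>Since |A| \<le> k + 2, every \<open>g j\<close> is affine, so its value at a + y is w_j
  + y v_j and the adjoint applies. \<open>S\<close> depends on the scheme alone, so one
  \<open>S\<close> serves both the basis of optimal I/O cost and the basis in which the bandwidth is
  computed. The numbers \<open>r y\<close> are the ranks.\<close>

lemma bandwidth_and_io_cost_via_fixed_points:
  fixes emb :: "'b::{field,finite} \<Rightarrow> 'f::{field,finite}" and g :: "'l::finite \<Rightarrow> 'f poly"
  assumes emb: "field_embedding emb" and l: "CARD('f) = CARD('b) ^ CARD('l)"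
    and A: "module.subspace (bscale emb) A" "vector_space.dim (bscale emb) A = d"
    and g: "linear_repair_scheme emb A k a g" "card A \<le> k + 2"
  obtains S where "linear_fixed_points emb S A d"
    and "\<And>\<beta> :: 'l \<Rightarrow> 'f. is_basis emb \<beta> \<Longrightarrow> io_cost emb A \<beta> g
      = (\<Sum>y\<in>A. int CARD('l) - int (card {s. \<beta> s \<in> linear_fixed_points.fixed S y})) - int CARD('l)"
    and "\<And>\<beta> :: 'l \<Rightarrow> 'f. is_basis emb \<beta> \<Longrightarrow>
      \<exists>r. repair_bandwidth emb A \<beta> g = (\<Sum>y\<in>A. int (r y)) - int CARD('l) \<and>
        (\<forall>y\<in>A. CARD('b) ^ r y * card (linear_fixed_points.fixed S y) = CARD('b) ^ CARD('l))"
proof -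
  interpret finite_field_extension emb by unfold_locales (rule emb)
  have ext: "CARD('l) = ext_degree emb"
    using l CARD_eq_power CARD_ge_2 by simp
  define w where "w j = poly (g j) a" for j
  define v where "v j = coeff (g j) 1" for j
  have w: "is_basis emb w" and aA: "a \<in> A"
    using g(1) is_basis_if_indep_family[OF _ ext] by (auto simp: linear_repair_scheme_def w_def[abs_def])
  have "degree (g j) \<le> 1" for j
  proof -
    have "g j = 0 \<or> degree (g j) < card A - k"
      using g(1) by (simp add: linear_repair_scheme_def)
    then show ?thesis
      using g(2) by (elim disjE) (simp, linarith)
  qed
  then have poly_g: "poly (g j) (y + a) = w j + y * v j" for j y
    using poly_eq_if_degree_le_1[of "g j" "y + a" a] by (simp add: w_def v_def)
  obtain S where S: "\<And>x y. S (x + y) = S x + S y" "\<And>c x. S (emb c * x) = emb c * S x"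
    "\<And>y z. (\<forall>j. field_trace emb ((w j + y * v j) * z) = 0) \<longleftrightarrow> S (y * z) = z"
    by (rule exists_adjoint[OF w ext, of v]) blast
  interpret linear_fixed_points emb S A d
    by unfold_locales (use S A in auto)
  have fixed_iff: "z \<in> fixed y \<longleftrightarrow> (\<forall>j. field_trace emb (poly (g j) (y + a) * z) = 0)" for y z
    by (simp add: fixed_def S(3) poly_g)
  \<comment> \<open>Translation by \<open>a\<close> permutes A, so sums over nodes become sums over
    y, with the failed node at y = 0.\<close>
  have shift: "bij_betw (\<lambda>y. y + a) A A"
    by (rule bij_betw_byWitness[where f' = "\<lambda>x. x - a"])
      (use aA vs.subspace_add[OF A(1)] vs.subspace_diff[OF A(1)] in auto)
  show thesis
  proof (rule that)
    show "linear_fixed_points emb S A d" by unfold_locales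
    fix \<beta> :: "'l \<Rightarrow> 'f" assume \<beta>: "is_basis emb \<beta>"
    have col: "column s (repair_matrix emb \<beta> g (y + a)) = 0 \<longleftrightarrow> \<beta> s \<in> fixed y" for s y
      by (simp add: fixed_iff column_def repair_matrix_def vec_eq_iff)
    have cols: "int (nonzero_columns (repair_matrix emb \<beta> g (y + a)))
        = int CARD('l) - int (card {s. \<beta> s \<in> fixed y})" for y
    proof -
      have "{s. \<beta> s \<notin> fixed y} = UNIV - {s. \<beta> s \<in> fixed y}" by auto
      moreover have "card {s. \<beta> s \<in> fixed y} \<le> CARD('l)" by (rule card_mono) auto
      ultimately show ?thesis
        by (simp add: nonzero_columns_def col card_Diff_subset of_nat_diff)
    qed
    then show "io_cost emb A \<beta> g
      = (\<Sum>y\<in>A. int CARD('l) - int (card {s. \<beta> s \<in> fixed y})) - int CARD('l)"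
      unfolding io_cost_def by (subst sum.reindex_bij_betw[OF shift, symmetric]) simp
    have "repair_bandwidth emb A \<beta> g
        = (\<Sum>y\<in>A. int (rank (repair_matrix emb \<beta> g (y + a)))) - int CARD('l)"
      unfolding repair_bandwidth_def by (subst sum.reindex_bij_betw[OF shift, symmetric]) simp
    moreover have "CARD('b) ^ rank (repair_matrix emb \<beta> g (y + a)) * card (fixed y) = CARD('b) ^ CARD('l)" for y
      using power_rank_times_card_perp[OF \<beta>, of g "y + a"] l by (simp flip: fixed_iff)
    ultimately show "\<exists>r. repair_bandwidth emb A \<beta> g = (\<Sum>y\<in>A. int (r y)) - int CARD('l) \<and>
        (\<forall>y\<in>A. CARD('b) ^ r y * card (fixed y) = CARD('b) ^ CARD('l))"
      by (intro exI[of _ "\<lambda>y. rank (repair_matrix emb \<beta> g (y + a))"]) simp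
  qed
qed

theorem theorem15:
  fixes emb :: "'b::{field,finite} \<Rightarrow> 'f::{field,finite}"
    and A :: "'f set" and a :: 'f
    and g :: "'l::finite \<Rightarrow> 'f poly" and \<beta> :: "'l \<Rightarrow> 'f"
    and q l d :: nat
  assumes "field_embedding emb"
    and "CARD('b) = q" and "CARD('l) = l" and "CARD('f) = q ^ l" and "l > 1"
    and "module.subspace (bscale emb) A" and "vector_space.dim (bscale emb) A = d"
    and "(int l - int d + 1) dvd int l"
    and "1 \<le> int (q ^ d) - 2"
    and "io_optimal_scheme emb d A a g"
    and "is_basis emb \<beta>"
  shows "(d = l \<and> q > 2 \<longrightarrow>
            repair_bandwidth emb A \<beta> g = (int q ^ l - 1) * int l - int q ^ (l - 1)) \<and>
         (d = l \<and> q = 2 \<longrightarrow>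
            repair_bandwidth emb A \<beta> g \<ge> (2 ^ l - 1) * int l - 3 * 2 ^ (l - 2)) \<and>
         (d < l \<longrightarrow>
            real_of_int (repair_bandwidth emb A \<beta> g)
              \<ge> (real q ^ d - 1) * real d - real q powi (2 * int d - int l - 1))"
proof -
  interpret finite_field_extension emb by unfold_locales (rule assms(1))
  have cardA: "card A = q ^ d"
    using vs.card_subspace[of A] assms(2,6,7) by simp
  have ext: "ext_degree emb = l"
    using assms(2,4) CARD_eq_power CARD_ge_2 by simp
  have q: "q \<ge> 2" using CARD_ge_2 assms(2) by simp
  \<comment> \<open>The code dimension q^d - 2 is at least 1, which excludes d = 0 as well as q = 2,
    d = 1.\<close>
  have qd: "q ^ d \<ge> 3" using assms(9) by linarith
  then have d: "d \<ge> 1" by (cases d) auto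
  obtain \<beta>\<^sub>0 :: "'l \<Rightarrow> 'f" where \<beta>\<^sub>0: "is_basis emb \<beta>\<^sub>0"
    and scheme: "linear_repair_scheme emb A (q ^ d - 2) a g"
    and opt: "io_cost emb A \<beta>\<^sub>0 g = (int (q ^ d) - 1) * int l - (int l - int d + 1) * int (q ^ (d - 1))"
    using assms(2,3,10) by (auto simp: io_optimal_scheme_def)
  have "CARD('f) = CARD('b) ^ CARD('l)" "card A \<le> q ^ d - 2 + 2"
    using assms(2-4) cardA by auto
  from bandwidth_and_io_cost_via_fixed_points[OF assms(1) this(1) assms(6,7) scheme this(2)]
  obtain S where "linear_fixed_points emb S A d"
    and io': "\<And>\<beta> :: 'l \<Rightarrow> 'f. is_basis emb \<beta> \<Longrightarrow> io_cost emb A \<beta> g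
      = (\<Sum>y\<in>A. int CARD('l) - int (card {s. \<beta> s \<in> linear_fixed_points.fixed S y})) - int CARD('l)"
    and bw: "\<And>\<beta> :: 'l \<Rightarrow> 'f. is_basis emb \<beta> \<Longrightarrow>
      \<exists>r. repair_bandwidth emb A \<beta> g = (\<Sum>y\<in>A. int (r y)) - int CARD('l) \<and>
        (\<forall>y\<in>A. CARD('b) ^ r y * card (linear_fixed_points.fixed S y) = CARD('b) ^ CARD('l))"
    by blast
  interpret linear_fixed_points emb S A d by fact
  have io: "io_cost emb A \<beta>\<^sub>0 g = (\<Sum>y\<in>A. int l - int (card {s. \<beta>\<^sub>0 s \<in> fixed y})) - int l"
    using io'[OF \<beta>\<^sub>0] assms(3) by simp
  have dl: "d \<le> l" using d_le ext by simp
  have "(\<Sum>s\<in>UNIV. card {y \<in> A. \<beta>\<^sub>0 s \<in> fixed y}) = (\<Sum>y\<in>A. card {s. \<beta>\<^sub>0 s \<in> fixed y})"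
    using sum_multicount_gen[of A UNIV "\<lambda>y s. \<beta>\<^sub>0 s \<in> fixed y"
        "\<lambda>s. card {y \<in> A. \<beta>\<^sub>0 s \<in> fixed y}"] by simp
  \<comment> \<open>The I/O cost falls short of (|A| - 1) l by exactly the number of zero columns; d
    \<le> l makes the natural subtraction l + 1 - d exact.\<close>
  moreover have "int (\<Sum>y\<in>A. card {s. \<beta>\<^sub>0 s \<in> fixed y}) = int ((l + 1 - d) * q ^ (d - 1))"
  proof -
    have "int (l + 1 - d) = int l - int d + 1" using dl by simp
    then show ?thesis
      unfolding of_nat_mult using io opt by (simp add: sum_subtractf cardA algebra_simps)
  qed
  ultimately have "(\<Sum>s\<in>UNIV. card {y \<in> A. \<beta>\<^sub>0 s \<in> fixed y}) = (l + 1 - d) * q ^ (d - 1)"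
    by linarith
  then have dich: "q ^ (d - 1) \<le> card kernel \<and> (\<forall>y\<in>A. card (fixed y) = q ^ card {s. \<beta>\<^sub>0 s \<in> fixed y})
    \<or> d = l \<and> q = 2 \<and> 2 ^ (l - 2) \<le> card kernel"
    using fixed_basis_dichotomy[OF \<beta>\<^sub>0 d] ext assms(2) by simp
  obtain r where r: "repair_bandwidth emb A \<beta> g = (\<Sum>y\<in>A. int (r y)) - int l"
    "\<And>y. y \<in> A \<Longrightarrow> q ^ r y * card (fixed y) = q ^ l"
    using bw[OF assms(11)] assms(2,3) by blast
  \<comment> \<open>If dim K_y is the number of zero columns at every node, each rank is the number
    of nonzero columns, so the bandwidth equals the optimal I/O cost.\<close>
  have bw_eq_io: "repair_bandwidth emb A \<beta> g = (int (q ^ d) - 1) * int l - (int l - int d + 1) * int (q ^ (d - 1))"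
    if "\<forall>y\<in>A. card (fixed y) = q ^ card {s. \<beta>\<^sub>0 s \<in> fixed y}"
  proof -
    have "int (r y) = int l - int (card {s. \<beta>\<^sub>0 s \<in> fixed y})" if y: "y \<in> A" for y
    proof -
      have "q ^ (r y + card {s. \<beta>\<^sub>0 s \<in> fixed y}) = q ^ l"
        using r(2)[OF y] that \<open>\<forall>y\<in>A. card (fixed y) = q ^ card {s. \<beta>\<^sub>0 s \<in> fixed y}\<close>
        by (simp add: power_add)
      then have "r y + card {s. \<beta>\<^sub>0 s \<in> fixed y} = l" using q by simp
      then show ?thesis by linarith
    qed
    then show ?thesis unfolding r(1) opt[symmetric] io by simp
  qed
  show ?thesis
  proof (intro conjI impI)
    assume "d = l \<and> q > 2"
    then show "repair_bandwidth emb A \<beta> g = (int q ^ l - 1) * int l - int q ^ (l - 1)"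
      using dich bw_eq_io by auto
  next
    assume *: "d = l \<and> q = 2"
    \<comment> \<open>The generic alternative gives even 2^(l-1), so one count of fixed points
      covers both alternatives.\<close>
    have "2 ^ (l - 2) \<le> card kernel"
      using dich
    proof
      assume "q ^ (d - 1) \<le> card kernel \<and> (\<forall>y\<in>A. card (fixed y) = q ^ card {s. \<beta>\<^sub>0 s \<in> fixed y})"
      then have "2 ^ (l - 1) \<le> card kernel" using * by simp
      moreover have "(2::nat) ^ (l - 2) \<le> 2 ^ (l - 1)" by (rule power_increasing) auto
      ultimately show ?thesis by (rule order_trans[rotated])
    qed simp
    then have "(\<Sum>y\<in>A. card (fixed y) - 1) + 2 ^ (l - 2) \<le> 2 ^ l"
      using sum_card_fixed_le ext assms(2) * by simp
    then have "int ((\<Sum>y\<in>A. card (fixed y) - 1) + 2 ^ (l - 2)) \<le> int (2 ^ l)"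
      by (simp only: of_nat_le_iff)
    \<comment> \<open>This produces the constant 3: 2^l - 2^(l-2) = 3 * 2^(l-2).\<close>
    moreover have "(2::int) ^ l = 4 * 2 ^ (l - 2)"
    proof -
      have "(2::int) ^ l = 2 ^ (2 + (l - 2))" using assms(5) by (intro arg_cong[where f = "(^) 2"]) simp
      then show ?thesis unfolding power_add by simp
    qed
    ultimately have sum_le: "(\<Sum>y\<in>A. int (card (fixed y) - 1)) \<le> 3 * 2 ^ (l - 2)"
      by simp
    \<comment> \<open>With t = dim K_y = l - r_y this is t \<le> 2^t - 1.\<close>
    have "int (r y) \<ge> int l - int (card (fixed y) - 1)" if y: "y \<in> A" for y
    proof -
      have eq: "2 ^ r y * card (fixed y) = (2::nat) ^ l" using r(2)[OF y] * by simp
      have "l - r y < card (fixed y)"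
      proof (rule ccontr)
        assume "\<not> ?thesis"
        then have "card (fixed y) \<le> l - r y" by simp
        also have "\<dots> < 2 ^ (l - r y)" by (rule less_exp)
        finally have "2 ^ r y * card (fixed y) < 2 ^ (r y + (l - r y))"
          by (simp add: power_add)
        moreover have "r y \<le> l"
          using dvd_triv_left[of "2 ^ r y" "card (fixed y)"] unfolding eq by (simp add: power_dvd_imp_le)
        ultimately show False using eq by simp
      qed
      then show ?thesis by linarith
    qed
    then have "(\<Sum>y\<in>A. int l - int (card (fixed y) - 1)) \<le> (\<Sum>y\<in>A. int (r y))"
      by (rule sum_mono)
    then have "int (card A) * int l - (\<Sum>y\<in>A. int (card (fixed y) - 1)) - int l \<le> repair_bandwidth emb A \<beta> g"
      unfolding r(1) by (simp add: sum_subtractf)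
    then show "repair_bandwidth emb A \<beta> g \<ge> (2 ^ l - 1) * int l - 3 * 2 ^ (l - 2)"
      using sum_le * by (simp add: cardA algebra_simps)
  next
    \<comment> \<open>The exceptional alternative has d = l, so the generic one holds and an
      estimate of the I/O cost remains.\<close>
    assume *: "d < l"
    then have "\<forall>y\<in>A. card (fixed y) = q ^ card {s. \<beta>\<^sub>0 s \<in> fixed y}" using dich by simp
    then have "real_of_int (repair_bandwidth emb A \<beta> g)
        = (real q ^ d - 1) * real l - (real l - real d + 1) * real q ^ (d - 1)"
      by (simp add: bw_eq_io)
    then show "real_of_int (repair_bandwidth emb A \<beta> g)
        \<ge> (real q ^ d - 1) * real d - real q powi (2 * int d - int l - 1)"
      using bandwidth_bound_arith[OF d * q qd] by simp
  qed
qed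

end
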